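(* Let $\mathcal{G}=(I_N,\mathcal{S},(A_i)_{i\in I_N},\pi^{(N)},(V_i)_{i\in I_N})$ be a game whose set of policy profiles $\pi^{(N)}=\prod_{i\in I_N}\pi_i$ is convex. Suppose that for some $s_0\in\mathcal{S}$ and for all $i,j\in I_N$, the value function $V_i^{s_0}:\pi^{(N)}\to\mathbb{R}$ has second-order linear derivatives with respect to $\pi_i\times\pi_j$ such that for all $z=(z_j)_{j\in I_N},\ \phi=(\phi_j)_{j\in I_N}\in\pi^{(N)}$, $\phi_i',\tilde\phi_i'\in\pi_i$ and $\phi_j''\in\pi_j$: (1) (Boundedness) $\sup_{r,\varepsilon\in[0,1]}\left|\frac{\delta^2V_i^{s_0}}{\delta\phi_i\delta\phi_j}\big(z+r(\phi^\varepsilon-z);\phi_i',\phi_j''\big)\right|<\infty$, where $\phi^\varepsilon:=(\phi_i+\varepsilon(\tilde\phi_i'-\phi_i),\phi_{-i})$; (2) (Continuity) $[0,1]^N\ni\varepsilon\mapsto\frac{\delta^2V_i^{s_0}}{\delta\phi_i\delta\phi_j}(z+\varepsilon\cdot(\phi-z);\phi_i',\phi_j'')$ is continuous at $0$, where $z+\varepsilon\cdot(\phi-z):=(z_i+\varepsilon_i(\phi_i-z_i))_{i\in I_N}$; (3) (Symmetric Jacobian) $\frac{\delta^2V_i^{s_0}}{\delta\phi_i\delta\phi_j}(\phi;\phi_i',\phi_j'')=\frac{\delta^2V_j^{s_0}}{\delta\phi_j\delta\phi_i}(\phi;\phi_j'',\phi_i')$. Then $\mathcal{G}$ with initial state $s_0$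 is a closed-loop potential game, and for any $z\in\pi^{(N)}$ the function $\Phi^{s_0}:\pi^{(N)}\to\mathbb{R}$ defined by $$\Phi^{s_0}(\phi)=\int_0^1\sum_{j=1}^N\frac{\delta V_j^{s_0}}{\delta\phi_j}(z+r(\phi-z);\phi_j-z_j)\,\mathrm{d}r$$ is a potential function. If for every $s_0\in\mathcal{S}$ and all $i,j\in I_N$ the value function $V_i^{s_0}$ has second-order linear derivatives with respect to $\pi_i\times\pi_j$ satisfying the boundedness condition (1), the continuity condition (2) and the symmetric Jacobian condition (3) for all $z,\phi\in\pi^{(N)}$, $\phi_i',\tilde\phi_i'\in\pi_i$ and $\phi_j''\in\pi_j$, then $\mathcal{G}$ is a Markov potential game with potential function $(s,\phi)\mapsto\Phi^{s}(\phi)$ defined by $\Phi^{s}(\phi)=\int_0^1\sum_{j=1}^N\frac{\delta V_j^{s}}{\delta\phi_j}(z+r(\phi-z);\phi_j-z_j)\,\mathrm{d}r$.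
   Context: Game. $\mathcal{G}$ consists of: $I_N=\{1,\dots,N\}$, $N\in\mathbb{N}$; a topological space $\mathcal{S}$ (state space); Borel subsets $A_i$ of topological vector spaces; $\pi^{(N)}=\prod_{i\in I_N}\pi_i$, where $\pi_i$ is a set of Borel measurable functions $\mathcal{S}\to A_i$; and value functions $V_i:\mathcal{S}\times\pi^{(N)}\to\mathbb{R}$, with $V_i^s(\phi):=V_i(s,\phi)$. Write $\pi^{(N)}_{-i}=\prod_{j\ne i}\pi_j$ and $\phi=(\phi_i,\phi_{-i})$ with $\phi_{-i}=(\phi_j)_{j\ne i}$. Potential games. $\mathcal{G}$ with initial state $s_0$ is a closed-loop potential game with potential function $\Phi^{s_0}:\pi^{(N)}\to\mathbb{R}$ if for all $i\in I_N$, $\phi_i,\phi_i'\in\pi_i$, $\phi_{-i}\in\pi_{-i}^{(N)}$: $\Phi^{s_0}((\phi_i',\phi_{-i}))-\Phi^{s_0}((\phi_i,\phi_{-i}))=V_i^{s_0}((\phi_i',\phi_{-i}))-V_i^{s_0}((\phi_i,\phi_{-i}))$. $\mathcal{G}$ is a Markov potential game with potential function $\Phi:\mathcal{S}\times\pi^{(N)}\to\mathbb{R}$ if for every $s_0\in\mathcal{S}$, $\Phi(s_0,\cdot)$ is a potential function of $\mathcal{G}$ with initial state $s_0$. Linear derivatives. Let $\mathrm{span}(\pi_i)$ be the real vector space of finite linear combinations of elements of $\pi_i$. Let $\pi^{(N)}$ be convex and $f:\pi^{(N)}\to\mathbb{R}$. $f$ has a linear derivative with respect to $\pi_i$ if there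 is $\frac{\delta f}{\delta\phi_i}:\pi^{(N)}\times\mathrm{span}(\pi_i)\to\mathbb{R}$ such that for all $\phi=(\phi_i,\phi_{-i})\in\pi^{(N)}$, $\frac{\delta f}{\delta\phi_i}(\phi;\cdot)$ is linear and $$\lim_{\varepsilon\downarrow0}\frac{f((\phi_i+\varepsilon(\phi_i'-\phi_i),\phi_{-i}))-f(\phi)}{\varepsilon}=\frac{\delta f}{\delta\phi_i}(\phi;\phi_i'-\phi_i)\quad\forall\phi_i'\in\pi_i.$$ $f$ has second-order linear derivatives with respect to $\pi_i\times\pi_j$ if (i) for all $k\in\{i,j\}$, $f$ has a linear derivative $\frac{\delta f}{\delta\phi_k}$ with respect to $\pi_k$, and (ii) for all $(k,\ell)\in\{(i,j),(j,i)\}$ there is $\frac{\delta^2f}{\delta\phi_k\delta\phi_\ell}:\pi^{(N)}\times\mathrm{span}(\pi_k)\times\mathrm{span}(\pi_\ell)\to\mathbb{R}$ such that for all $\phi\in\pi^{(N)}$, $\frac{\delta^2f}{\delta\phi_k\delta\phi_\ell}(\phi;\cdot,\cdot)$ is bilinear and for all $\phi_k'\in\mathrm{span}(\pi_k)$, $\frac{\delta^2f}{\delta\phi_k\delta\phi_\ell}(\cdot;\phi_k',\cdot)$ is a linear derivative of $\frac{\delta f}{\delta\phi_k}(\cdot;\phi_k')$ with respect to $\pi_\ell$. Linear derivatives need not be unique; a choice of first-order derivatives $\frac{\delta V_i^{s_0}}{\delta\phi_k}$ and of associated second-order derivatives is fixed throughout (for each $i$ the same $\frac{\delta V_i^{s_0}}{\delta\phi_i}$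 is used for all $j$), and the result holds for any such choice. *)

theory Defs
  imports "HOL-Analysis.Analysis" "HOL-Library.Function_Algebras"
begin

instantiation "fun" :: (type, real_vector) real_vector
begin

definition scaleR_fun_def: "c *\<^sub>R f = (\<lambda>x. c *\<^sub>R f x)"

instance
  by standard (simp_all add: scaleR_fun_def fun_eq_iff scaleR_add_right scaleR_add_left)

end

lemma scaleR_fun_apply [simp]: "(c *\<^sub>R f) x = c *\<^sub>R f x"
  by (simp add: scaleR_fun_def)

text \<open>
  Topological vector spaces are linear subspaces of an ambient real vector space, each with a
  topology of its own (Hausdorff or not). In this way the players can have different action spaces
  although their actions share one type: any family of topological vector spaces is of this form,
  with its direct sum as ambient space.
\<close>

definition topological_vector_space :: "'a::real_vector topology \<Rightarrow> bool" where
  "topological_vector_space T \<longleftrightarrow>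
     subspace (topspace T) \<and>
     continuous_map (prod_topology T T) T (\<lambda>(x, y). x + y) \<and>
     continuous_map (prod_topology euclideanreal T) T (\<lambda>(c, x). c *\<^sub>R x)"

definition borel_of_topology :: "'a topology \<Rightarrow> 'a measure" where
  "borel_of_topology T = sigma (topspace T) {U. openin T U}"

type_synonym ('s, 'a) policy = "'s \<Rightarrow> 'a"
type_synonym ('s, 'a) profile = "nat \<Rightarrow> 's \<Rightarrow> 'a"

text \<open>
  The state space is the type \<open>'s\<close>; player \<open>i\<close> has the topological vector space \<open>T i\<close>, the action
  set \<open>A i\<close>, the policy set \<open>\<pi> i\<close> and the value function \<open>V i\<close>. Nothing is required of the value
  functions, so the predicate defined by the locale does not take \<open>V\<close> as an argument.
\<close>

locale game =
  fixes N :: nat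
    and T :: "nat \<Rightarrow> 'a::real_vector topology"
    and A :: "nat \<Rightarrow> 'a set"
    and \<pi> :: "nat \<Rightarrow> ('s::topological_space, 'a) policy set"
    and V :: "nat \<Rightarrow> 's \<Rightarrow> ('s, 'a) profile \<Rightarrow> real"
  assumes action_space: "\<And>i. i \<in> {1..N} \<Longrightarrow> topological_vector_space (T i)"
    and action_set: "\<And>i. i \<in> {1..N} \<Longrightarrow> A i \<in> sets (borel_of_topology (T i))"
    and policy_set:
      "\<And>i. i \<in> {1..N} \<Longrightarrow> \<pi> i \<subseteq> borel \<rightarrow>\<^sub>M restrict_space (borel_of_topology (T i)) (A i)"

text \<open>
  Profiles take the value \<^const>\<open>undefined\<close> outside \<open>{1..N}\<close>. Affine combinations preserve this value,
  so the vector space operations of the type can be used for convexity of the set of profiles and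
  for the segments \<open>z + r *\<^sub>R (\<phi> - z)\<close>.
\<close>

definition profiles :: "nat \<Rightarrow> (nat \<Rightarrow> ('s, 'a) policy set) \<Rightarrow> ('s, 'a) profile set" where
  "profiles N \<pi> = PiE {1..N} \<pi>"

definition closed_loop_potential_function ::
  "nat \<Rightarrow> (nat \<Rightarrow> ('s, 'a) policy set) \<Rightarrow> (nat \<Rightarrow> 's \<Rightarrow> ('s, 'a) profile \<Rightarrow> real) \<Rightarrow> 's
    \<Rightarrow> (('s, 'a) profile \<Rightarrow> real) \<Rightarrow> bool" where
  "closed_loop_potential_function N \<pi> V s\<^sub>0 \<Phi> \<longleftrightarrow>
     (\<forall>i\<in>{1..N}. \<forall>p\<in>\<pi> i. \<forall>p'\<in>\<pi> i. \<forall>\<psi>\<in>PiE ({1..N} - {i}) \<pi>.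
        \<Phi> (\<psi>(i := p')) - \<Phi> (\<psi>(i := p)) = V i s\<^sub>0 (\<psi>(i := p')) - V i s\<^sub>0 (\<psi>(i := p)))"

definition closed_loop_potential_game ::
  "nat \<Rightarrow> (nat \<Rightarrow> ('s, 'a) policy set) \<Rightarrow> (nat \<Rightarrow> 's \<Rightarrow> ('s, 'a) profile \<Rightarrow> real) \<Rightarrow> 's \<Rightarrow> bool" where
  "closed_loop_potential_game N \<pi> V s\<^sub>0 \<longleftrightarrow> (\<exists>\<Phi>. closed_loop_potential_function N \<pi> V s\<^sub>0 \<Phi>)"

definition Markov_potential_function ::
  "nat \<Rightarrow> (nat \<Rightarrow> ('s, 'a) policy set) \<Rightarrow> (nat \<Rightarrow> 's \<Rightarrow> ('s, 'a) profile \<Rightarrow> real)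
    \<Rightarrow> ('s \<Rightarrow> ('s, 'a) profile \<Rightarrow> real) \<Rightarrow> bool" where
  "Markov_potential_function N \<pi> V \<Phi> \<longleftrightarrow> (\<forall>s\<^sub>0. closed_loop_potential_function N \<pi> V s\<^sub>0 (\<Phi> s\<^sub>0))"

definition Markov_potential_game ::
  "nat \<Rightarrow> (nat \<Rightarrow> ('s, 'a) policy set) \<Rightarrow> (nat \<Rightarrow> 's \<Rightarrow> ('s, 'a) profile \<Rightarrow> real) \<Rightarrow> bool" where
  "Markov_potential_game N \<pi> V \<longleftrightarrow> (\<exists>\<Phi>. Markov_potential_function N \<pi> V \<Phi>)"

definition linear_functional_on :: "'v::real_vector set \<Rightarrow> ('v \<Rightarrow> real) \<Rightarrow> bool" where
  "linear_functional_on W g \<longleftrightarrow>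
     (\<forall>u\<in>W. \<forall>v\<in>W. g (u + v) = g u + g v) \<and> (\<forall>c. \<forall>u\<in>W. g (c *\<^sub>R u) = c * g u)"

definition bilinear_functional_on ::
  "'v::real_vector set \<Rightarrow> 'w::real_vector set \<Rightarrow> ('v \<Rightarrow> 'w \<Rightarrow> real) \<Rightarrow> bool" where
  "bilinear_functional_on W X g \<longleftrightarrow>
     (\<forall>u\<in>W. linear_functional_on X (g u)) \<and> (\<forall>v\<in>X. linear_functional_on W (\<lambda>u. g u v))"

definition linear_derivative ::
  "nat \<Rightarrow> (nat \<Rightarrow> ('s, 'a::real_vector) policy set) \<Rightarrow> nat \<Rightarrow> (('s, 'a) profile \<Rightarrow> real)
    \<Rightarrow> (('s, 'a) profile \<Rightarrow> ('s, 'a) policy \<Rightarrow> real) \<Rightarrow> bool" where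
  "linear_derivative N \<pi> i f D \<longleftrightarrow>
     (\<forall>\<phi>\<in>profiles N \<pi>.
        linear_functional_on (span (\<pi> i)) (D \<phi>) \<and>
        (\<forall>p'\<in>\<pi> i.
           ((\<lambda>\<epsilon>::real. (f (\<phi>(i := \<phi> i + \<epsilon> *\<^sub>R (p' - \<phi> i))) - f \<phi>) / \<epsilon>)
              \<longlongrightarrow> D \<phi> (p' - \<phi> i)) (at_right 0)))"

text \<open>
  In the following \<open>D k\<close> is the linear derivative with respect to \<open>\<pi> k\<close>, and \<open>D2 k l\<close> the one of
  \<open>D k\<close> with respect to \<open>\<pi> l\<close>; its second argument lies in \<open>span (\<pi> k)\<close> and its third in
  \<open>span (\<pi> l)\<close>.
\<close>

definition second_order_linear_derivatives ::
  "nat \<Rightarrow> (nat \<Rightarrow> ('s, 'a::real_vector) policy set) \<Rightarrow> nat \<Rightarrow> nat \<Rightarrow> (('s, 'a) profile \<Rightarrow> real)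
    \<Rightarrow> (nat \<Rightarrow> ('s, 'a) profile \<Rightarrow> ('s, 'a) policy \<Rightarrow> real)
    \<Rightarrow> (nat \<Rightarrow> nat \<Rightarrow> ('s, 'a) profile \<Rightarrow> ('s, 'a) policy \<Rightarrow> ('s, 'a) policy \<Rightarrow> real) \<Rightarrow> bool" where
  "second_order_linear_derivatives N \<pi> i j f D D2 \<longleftrightarrow>
     (\<forall>k\<in>{i, j}. linear_derivative N \<pi> k f (D k)) \<and>
     (\<forall>(k, l)\<in>{(i, j), (j, i)}.
        (\<forall>\<phi>\<in>profiles N \<pi>. bilinear_functional_on (span (\<pi> k)) (span (\<pi> l)) (D2 k l \<phi>)) \<and>
        (\<forall>u\<in>span (\<pi> k). linear_derivative N \<pi> l (\<lambda>\<phi>. D k \<phi> u) (\<lambda>\<phi>. D2 k l \<phi> u)))"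

text \<open>The cube \<open>[0,1]\<^sup>N\<close>; the coordinates outside \<open>{1..N}\<close> are fixed to be zero.\<close>

definition unit_cube :: "nat \<Rightarrow> (nat \<Rightarrow> real) set" where
  "unit_cube N = {\<epsilon>. (\<forall>i\<in>{1..N}. \<epsilon> i \<in> {0..1}) \<and> (\<forall>i. i \<notin> {1..N} \<longrightarrow> \<epsilon> i = 0)}"

text \<open>
  For a fixed initial state, \<open>W i\<close> is the value function of player \<open>i\<close>; \<open>D i k\<close> and \<open>D2 i k l\<close> are
  its chosen first- and second-order derivatives. The pair \<open>(i, j)\<close> only involves \<open>D i i\<close>, \<open>D i j\<close>,
  \<open>D2 i i j\<close> and \<open>D2 i j i\<close>, so the only choice shared by different \<open>j\<close> is that of \<open>D i i\<close>.
\<close>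

definition symmetric_derivative_conditions ::
  "nat \<Rightarrow> (nat \<Rightarrow> ('s, 'a::real_vector) policy set) \<Rightarrow> (nat \<Rightarrow> ('s, 'a) profile \<Rightarrow> real)
    \<Rightarrow> (nat \<Rightarrow> nat \<Rightarrow> ('s, 'a) profile \<Rightarrow> ('s, 'a) policy \<Rightarrow> real)
    \<Rightarrow> (nat \<Rightarrow> nat \<Rightarrow> nat \<Rightarrow> ('s, 'a) profile \<Rightarrow> ('s, 'a) policy \<Rightarrow> ('s, 'a) policy \<Rightarrow> real)
    \<Rightarrow> bool" where
  "symmetric_derivative_conditions N \<pi> W D D2 \<longleftrightarrow>
     (\<forall>i\<in>{1..N}. \<forall>j\<in>{1..N}.
        second_order_linear_derivatives N \<pi> i j (W i) (D i) (D2 i) \<and>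
        (\<forall>z\<in>profiles N \<pi>. \<forall>\<phi>\<in>profiles N \<pi>. \<forall>p'\<in>\<pi> i. \<forall>q'\<in>\<pi> i. \<forall>p''\<in>\<pi> j.
           bdd_above ((\<lambda>(r::real, \<epsilon>::real).
               \<bar>D2 i i j (z + r *\<^sub>R (\<phi>(i := \<phi> i + \<epsilon> *\<^sub>R (q' - \<phi> i)) - z)) p' p''\<bar>) `
             ({0..1} \<times> {0..1})) \<and>
           continuous (at 0 within unit_cube N)
             (\<lambda>\<epsilon>. D2 i i j (\<lambda>k. z k + \<epsilon> k *\<^sub>R (\<phi> k - z k)) p' p'') \<and>
           D2 i i j \<phi> p' p'' = D2 j j i \<phi> p'' p'))"

definition potential_integrand ::
  "nat \<Rightarrow> (nat \<Rightarrow> nat \<Rightarrow> ('s, 'a::real_vector) profile \<Rightarrow> ('s, 'a) policy \<Rightarrow> real)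
    \<Rightarrow> ('s, 'a) profile \<Rightarrow> ('s, 'a) profile \<Rightarrow> real \<Rightarrow> real" where
  "potential_integrand N D z \<phi> r = (\<Sum>j=1..N. D j j (z + r *\<^sub>R (\<phi> - z)) (\<phi> j - z j))"

definition integral_potential ::
  "nat \<Rightarrow> (nat \<Rightarrow> nat \<Rightarrow> ('s, 'a::real_vector) profile \<Rightarrow> ('s, 'a) policy \<Rightarrow> real)
    \<Rightarrow> ('s, 'a) profile \<Rightarrow> ('s, 'a) profile \<Rightarrow> real" where
  "integral_potential N D z \<phi> = (LBINT r:{0..1}. potential_integrand N D z \<phi> r)"

end

theory Submission
  imports Defs
begin

text \<open>
  Read the derivatives \<open>F\<^sub>j(\<phi>; \<cdot>) = \<delta>V\<^sub>j/\<delta>\<phi>\<^sub>j(\<phi>; \<cdot>)\<close> as the components of a one-form on the convex set of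
  profiles. The symmetry condition says that this form is closed, and \<open>\<Phi>\<close> is its radial primitive
  with centre \<open>z\<close>, as in the Poincare lemma. A primitive of the form changes along a unilateral
  deviation of player \<open>i\<close> at the rate \<open>F\<^sub>i\<close>, which is also the rate of change of \<open>V\<^sub>i\<close>.

  In detail, let player \<open>i\<close> deviate along \<open>\<phi>\<^sup>\<epsilon> = (\<phi>\<^sub>i + \<epsilon> u, \<phi>\<^sub>-\<^sub>i)\<close> with \<open>u = q - \<phi>\<^sub>i\<close>, and let
  \<open>\<sigma>(\<epsilon>, r) = z + r (\<phi>\<^sup>\<epsilon> - z)\<close> be the surface swept out by the segments from \<open>z\<close>. With \<open>H\<^sub>i\<^sub>j\<close> the
  derivative of \<open>F\<^sub>i\<close> with respect to \<open>\<pi>\<^sub>j\<close>, the integrand \<open>\<Sum>\<^sub>j F\<^sub>j(\<sigma>; \<phi>\<^sup>\<epsilon>\<^sub>j - z\<^sub>j)\<close> of \<open>\<Phi>(\<phi>\<^sup>\<epsilon>)\<close> has the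
  \<open>\<epsilon>\<close>-derivative \<open>F\<^sub>i(\<sigma>; u) + r \<Sum>\<^sub>j H\<^sub>j\<^sub>i(\<sigma>; \<phi>\<^sup>\<epsilon>\<^sub>j - z\<^sub>j, u)\<close>
  (\<open>integrand_derivative\<close>). By symmetry this is \<open>F\<^sub>i(\<sigma>; u) + r \<Sum>\<^sub>j H\<^sub>i\<^sub>j(\<sigma>; u, \<phi>\<^sup>\<epsilon>\<^sub>j - z\<^sub>j)\<close>, which by
  the chain rule is the \<open>r\<close>-derivative of \<open>r F\<^sub>i(\<sigma>; u)\<close> (\<open>radial_derivative\<close>). Differentiating under
  the integral and then integrating in \<open>r\<close> gives \<open>d/d\<epsilon> \<Phi>(\<phi>\<^sup>\<epsilon>) = F\<^sub>i(\<phi>\<^sup>\<epsilon>; u)\<close>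
  (\<open>integral_potential_derivative\<close>).

  The analytic work is due to the weak hypotheses. The derivatives are one-sided and taken along a
  single coordinate, but a convex domain allows moving towards both ends of a segment, which makes
  them two-sided (\<open>has_real_derivative_on_unit_interval_by_endpoints\<close>). Derivatives along the
  segments from \<open>z\<close>, which move all coordinates, come from changing one coordinate after the other;
  the mean value theorem puts each increment at a point of a shrinking box, and the continuity
  condition gives the limit (\<open>chain_rule_along_segment\<close>). The integral is
  differentiated by dominated convergence, and the boundedness condition provides the majorant
  (\<open>leibniz_rule_bounded_derivative\<close>).
\<close>

section \<open>Differentiation on the unit interval\<close>

text \<open>
  A linear derivative at \<open>t\<close> is tested by moving a fraction \<open>\<epsilon>\<close> of the way towards another policy. On a
  segment the only targets needed are the two ends, at signed distances \<open>1 - t\<close> and \<open>- t\<close>; this is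
  the form in which the one-sided quotients arise below.
\<close>

lemma has_real_derivative_on_unit_interval_by_endpoints:
  fixes h :: "real \<Rightarrow> real"
  assumes t: "t \<in> {0..1}"
    and right: "t < 1 \<Longrightarrow> ((\<lambda>\<epsilon>. (h (t + \<epsilon> * (1 - t)) - h t) / \<epsilon>) \<longlongrightarrow> (1 - t) * d) (at_right 0)"
    and left: "0 < t \<Longrightarrow> ((\<lambda>\<epsilon>. (h (t - \<epsilon> * t) - h t) / \<epsilon>) \<longlongrightarrow> - t * d) (at_right 0)"
  shows "(h has_real_derivative d) (at t within {0..1})"
proof -
  let ?q = "\<lambda>y. (h y - h t) / (y - t)"
  have "(?q \<longlongrightarrow> d) (at t within {t..1})"
  proof (cases "t < 1")
    case True
    have "((\<lambda>y. (y - t) / (1 - t)) \<longlongrightarrow> (t - t) / (1 - t)) (at t within {t..1})"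
      using True by (intro tendsto_intros) auto
    then have "filterlim (\<lambda>y. (y - t) / (1 - t)) (at_right 0) (at t within {t..1})"
      using True by (auto simp: filterlim_at eventually_at_filter)
    from filterlim_compose[OF right[OF True] this]
    have "((\<lambda>y. (h (t + (y - t) / (1 - t) * (1 - t)) - h t) / ((y - t) / (1 - t)) / (1 - t)) \<longlongrightarrow> (1 - t) * d / (1 - t))
        (at t within {t..1})"
      using True by (intro tendsto_divide) auto
    then show ?thesis
      using True by simp
  next
    case False
    with t have "{t..1} = {t}" by auto
    then show ?thesis by (simp add: at_within_def)
  qed
  moreover have "(?q \<longlongrightarrow> d) (at t within {0..t})"
  proof (cases "0 < t")
    case True
    have "((\<lambda>y. (t - y) / t) \<longlongrightarrow> (t - t) / t) (at t within {0..t})"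
      using True by (intro tendsto_intros) auto
    then have "filterlim (\<lambda>y. (t - y) / t) (at_right 0) (at t within {0..t})"
      using True by (auto simp: filterlim_at eventually_at_filter)
    from filterlim_compose[OF left[OF True] this]
    have "((\<lambda>y. (h (t - (t - y) / t * t) - h t) / ((t - y) / t) / (- t)) \<longlongrightarrow> (- t * d) / (- t))
        (at t within {0..t})"
      using True by (intro tendsto_divide) auto
    moreover have "(h (t - (t - y) / t * t) - h t) / ((t - y) / t) / (- t) = ?q y" for y
      using True by (cases "y = t") (auto simp: field_simps)
    ultimately show ?thesis
      using True by simp
  next
    case False
    with t have "{0..t} = {t}" by auto
    then show ?thesis by (simp add: at_within_def)
  qed
  ultimately have "(?q \<longlongrightarrow> d) (at t within ({t..1} \<union> {0..t}))"
    by (rule Lim_Un)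
  moreover have "{t..1} \<union> {0..t} = {0..1}" using t by auto
  ultimately show ?thesis by (simp add: has_field_derivative_iff)
qed

text \<open>
  By the mean value inequality the bound \<open>C\<close> on \<open>g'\<close> dominates all difference quotients of \<open>g\<close>, so
  dominated convergence applies to the quotients along any sequence tending to \<open>\<epsilon>\<close>.
\<close>

lemma leibniz_rule_bounded_derivative:
  fixes g g' :: "real \<Rightarrow> real \<Rightarrow> real"
  assumes deriv: "\<And>\<epsilon> r. \<epsilon> \<in> {0..1} \<Longrightarrow> r \<in> {0..1} \<Longrightarrow>
                    ((\<lambda>\<epsilon>. g \<epsilon> r) has_real_derivative g' \<epsilon> r) (at \<epsilon> within {0..1})"
    and bound: "\<And>\<epsilon> r. \<epsilon> \<in> {0..1} \<Longrightarrow> r \<in> {0..1} \<Longrightarrow> \<bar>g' \<epsilon> r\<bar> \<le> C"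
    and int: "\<And>\<epsilon>. \<epsilon> \<in> {0..1} \<Longrightarrow> g \<epsilon> integrable_on {0..1}"
    and \<epsilon>: "\<epsilon> \<in> {0..1}"
  shows "((\<lambda>\<epsilon>. integral {0..1} (g \<epsilon>)) has_real_derivative integral {0..1} (g' \<epsilon>)) (at \<epsilon> within {0..1})"
  unfolding has_field_derivative_iff tendsto_at_iff_sequentially
proof (intro allI impI)
  fix X :: "nat \<Rightarrow> real"
  assume X: "\<forall>n. X n \<in> {0..1} - {\<epsilon>}" "X \<longlonglongrightarrow> \<epsilon>"
  let ?f = "\<lambda>n r. (g (X n) r - g \<epsilon> r) / (X n - \<epsilon>)"
  have X01: "X n \<in> {0..1}" for n using X(1) by blast
  have "(\<lambda>n. integral {0..1} (?f n)) \<longlonglongrightarrow> integral {0..1} (g' \<epsilon>)"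
  proof (rule dominated_convergence(2))
    show "?f n integrable_on {0..1}" for n
      by (intro integrable_on_divide integrable_diff int X01 \<epsilon>)
    show "(\<lambda>r::real. C) integrable_on {0..1}" by (rule integrable_const_ivl)
    show "norm (?f n r) \<le> C" if r: "r \<in> {0..1}" for n r
    proof -
      have "norm (g (X n) r - g \<epsilon> r) \<le> C * norm (X n - \<epsilon>)"
        by (rule field_differentiable_bound[OF _ deriv[OF _ r]]) (use bound r X01 \<epsilon> in auto)
      then show ?thesis
        using X(1) by (simp add: divide_le_eq)
    qed
    show "(\<lambda>n. ?f n r) \<longlonglongrightarrow> g' \<epsilon> r" if r: "r \<in> {0..1}" for r
      using deriv[OF \<epsilon> r] X
      unfolding has_field_derivative_iff tendsto_at_iff_sequentially comp_def by blast
  qed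
  moreover have "integral {0..1} (?f n) = (integral {0..1} (g (X n)) - integral {0..1} (g \<epsilon>)) / (X n - \<epsilon>)" for n
    unfolding integral_divide integral_diff[OF int[OF X01] int[OF \<epsilon>]] ..
  ultimately show "((\<lambda>y. (integral {0..1} (g y) - integral {0..1} (g \<epsilon>)) / (y - \<epsilon>)) \<circ> X)
      \<longlonglongrightarrow> integral {0..1} (g' \<epsilon>)"
    by (simp only: comp_def)
qed

section \<open>Segments and boxes of profiles\<close>

lemma profiles_upd:
  assumes "\<phi> \<in> profiles N \<pi>" "i \<in> {1..N}" "p \<in> \<pi> i"
  shows "\<phi>(i := p) \<in> profiles N \<pi>"
  using assms by (auto simp: profiles_def PiE_iff extensional_def)

lemma profilesD: "\<phi> \<in> profiles N \<pi> \<Longrightarrow> i \<in> {1..N} \<Longrightarrow> \<phi> i \<in> \<pi> i"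
  by (auto simp: profiles_def)

lemma profiles_outside: "\<phi> \<in> profiles N \<pi> \<Longrightarrow> i \<notin> {1..N} \<Longrightarrow> \<phi> i = undefined"
  by (auto simp: profiles_def PiE_iff extensional_def)

lemma profiles_segment:
  assumes "convex (profiles N \<pi>)" "z \<in> profiles N \<pi>" "\<phi> \<in> profiles N \<pi>" "r \<in> {0..1}"
  shows "z + r *\<^sub>R (\<phi> - z) \<in> profiles N \<pi>"
proof -
  have "z + r *\<^sub>R (\<phi> - z) = (1 - r) *\<^sub>R z + r *\<^sub>R \<phi>" by (simp add: algebra_simps)
  then show ?thesis using assms by (simp add: convex_alt)
qed

text \<open>
  Convexity of a product gives convexity of a factor only when the product is nonempty, hence the
  profile \<open>\<phi>\<close>.
\<close>

lemma policies_segment: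
  assumes conv: "convex (profiles N \<pi>)" and ne: "\<phi> \<in> profiles N \<pi>"
    and i: "i \<in> {1..N}" and p: "p \<in> \<pi> i" and q: "q \<in> \<pi> i" and t: "t \<in> {0..1}"
  shows "p + t *\<^sub>R (q - p) \<in> \<pi> i"
proof -
  have "\<phi>(i := p) + t *\<^sub>R (\<phi>(i := q) - \<phi>(i := p)) \<in> profiles N \<pi>"
    using assms by (intro profiles_segment profiles_upd)
  from profilesD[OF this i] show ?thesis by (simp add: plus_fun_def fun_diff_def)
qed

lemma profiles_box:
  assumes conv: "convex (profiles N \<pi>)" and y: "y \<in> profiles N \<pi>" and x: "x \<in> profiles N \<pi>"
    and e: "e \<in> unit_cube N"
  shows "(\<lambda>k. y k + e k *\<^sub>R (x k - y k)) \<in> profiles N \<pi>"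
proof -
  have "y k + e k *\<^sub>R (x k - y k) \<in> \<pi> k" if "k \<in> {1..N}" for k
    using policies_segment[OF conv y that] profilesD[OF y that] profilesD[OF x that] e that
    by (auto simp: unit_cube_def)
  moreover have "y k + e k *\<^sub>R (x k - y k) = undefined" if "k \<notin> {1..N}" for k
    using e that profiles_outside[OF y that] by (auto simp: unit_cube_def)
  ultimately show ?thesis by (auto simp: profiles_def PiE_iff extensional_def)
qed

section \<open>Linear derivatives along segments\<close>

lemma diff_in_span: "p \<in> S \<Longrightarrow> q \<in> S \<Longrightarrow> p - q \<in> span S"
  by (simp add: span_base span_diff)

lemma linear_functional_on_scaleR:
  "linear_functional_on W g \<Longrightarrow> u \<in> W \<Longrightarrow> g (c *\<^sub>R u) = c * g u"
  by (simp add: linear_functional_on_def)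

lemma linear_functional_on_add:
  "linear_functional_on W g \<Longrightarrow> u \<in> W \<Longrightarrow> v \<in> W \<Longrightarrow> g (u + v) = g u + g v"
  by (simp add: linear_functional_on_def)

lemma linear_functional_on_diff:
  assumes "linear_functional_on (span S) g" "u \<in> span S" "v \<in> span S"
  shows "g (u - v) = g u - g v"
  using linear_functional_on_add[OF assms(1,2) span_neg[OF assms(3)]]
    linear_functional_on_scaleR[OF assms(1,3), of "-1"] by simp

lemma linear_functional_on_add_scaled:
  assumes "linear_functional_on (span S) g" "u \<in> span S" "v \<in> span S"
  shows "g (u + c *\<^sub>R v) = g u + c * g v"
  using linear_functional_on_add[OF assms(1,2) span_scale[OF assms(3)]]
    linear_functional_on_scaleR[OF assms(1,3)] by simp

text \<open>
  From a point of the segment both ends are admissible targets, and both directions are multiples of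
  \<open>q - p\<close>; by linearity the two one-sided derivatives agree.
\<close>

lemma linear_derivative_along_segment:
  assumes conv: "convex (profiles N \<pi>)" and D: "linear_derivative N \<pi> i f D"
    and i: "i \<in> {1..N}" and \<phi>: "\<phi> \<in> profiles N \<pi>"
    and p: "p \<in> \<pi> i" and q: "q \<in> \<pi> i" and t: "t \<in> {0..1}"
  shows "((\<lambda>t. f (\<phi>(i := p + t *\<^sub>R (q - p)))) has_real_derivative
           D (\<phi>(i := p + t *\<^sub>R (q - p))) (q - p)) (at t within {0..1})"
proof -
  define \<psi> where "\<psi> = \<phi>(i := p + t *\<^sub>R (q - p))"
  have \<psi>: "\<psi> \<in> profiles N \<pi>"
    unfolding \<psi>_def by (intro profiles_upd \<phi> i policies_segment[OF conv \<phi> i p q t])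
  have lin: "linear_functional_on (span (\<pi> i)) (D \<psi>)"
    and quot: "\<And>p'. p' \<in> \<pi> i \<Longrightarrow>
      ((\<lambda>\<epsilon>. (f (\<psi>(i := \<psi> i + \<epsilon> *\<^sub>R (p' - \<psi> i))) - f \<psi>) / \<epsilon>) \<longlongrightarrow> D \<psi> (p' - \<psi> i)) (at_right 0)"
    using D \<psi> by (auto simp: linear_derivative_def)
  have scale: "D \<psi> (c *\<^sub>R (q - p)) = c * D \<psi> (q - p)" for c
    by (rule linear_functional_on_scaleR[OF lin diff_in_span[OF q p]])
  show ?thesis
    unfolding \<psi>_def[symmetric]
  proof (rule has_real_derivative_on_unit_interval_by_endpoints[OF t])
    have "q - \<psi> i = (1 - t) *\<^sub>R (q - p)" by (simp add: \<psi>_def algebra_simps)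
    moreover have "\<psi>(i := \<psi> i + \<epsilon> *\<^sub>R (q - \<psi> i)) = \<phi>(i := p + (t + \<epsilon> * (1 - t)) *\<^sub>R (q - p))" for \<epsilon>
      by (simp add: \<psi>_def algebra_simps)
    ultimately show "((\<lambda>\<epsilon>. (f (\<phi>(i := p + (t + \<epsilon> * (1 - t)) *\<^sub>R (q - p))) - f (\<phi>(i := p + t *\<^sub>R (q - p)))) / \<epsilon>)
        \<longlongrightarrow> (1 - t) * D \<psi> (q - p)) (at_right 0)"
      using quot[OF q] by (simp only: scale flip: \<psi>_def)
  next
    have "p - \<psi> i = (- t) *\<^sub>R (q - p)" by (simp add: \<psi>_def algebra_simps)
    moreover have "\<psi>(i := \<psi> i + \<epsilon> *\<^sub>R (p - \<psi> i)) = \<phi>(i := p + (t - \<epsilon> * t) *\<^sub>R (q - p))" for \<epsilon>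
      by (simp add: \<psi>_def algebra_simps)
    ultimately show "((\<lambda>\<epsilon>. (f (\<phi>(i := p + (t - \<epsilon> * t) *\<^sub>R (q - p))) - f (\<phi>(i := p + t *\<^sub>R (q - p)))) / \<epsilon>)
        \<longlongrightarrow> - t * D \<psi> (q - p)) (at_right 0)"
      using quot[OF p] by (simp only: scale flip: \<psi>_def)
  qed
qed

lemma tendsto_fun_componentwise:
  fixes f :: "'b \<Rightarrow> 'c \<Rightarrow> 'd::topological_space"
  assumes "\<And>k. ((\<lambda>x. f x k) \<longlongrightarrow> l k) F"
  shows "(f \<longlongrightarrow> l) F"
  using assms
  by (simp add: limitin_componentwise flip: limitin_canonical_iff euclidean_product_topology)

text \<open>
  The step from \<open>y\<close> to \<open>y + h (x - y)\<close> is split into \<open>N\<close> steps that move a single coordinate each. By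
  the mean value theorem the \<open>m\<close>-th increment is \<open>h\<close> times the value of \<open>H m\<close>, in direction
  \<open>x m - y m\<close>, at a point of the box spanned by \<open>y\<close> and \<open>y + h (x - y)\<close>. Since this box shrinks to its corner \<open>y\<close>, continuity of \<open>H m\<close> at the corner,
  within the box, suffices.
\<close>

lemma tendsto_diagonal_quotient:
  assumes conv: "convex (profiles N \<pi>)"
    and H: "\<And>j. j \<in> {1..N} \<Longrightarrow> linear_derivative N \<pi> j f (H j)"
    and cont: "\<And>j. j \<in> {1..N} \<Longrightarrow>
      continuous (at 0 within unit_cube N) (\<lambda>e. H j (\<lambda>k. y k + e k *\<^sub>R (x k - y k)) (x j - y j))"
    and y: "y \<in> profiles N \<pi>" and x: "x \<in> profiles N \<pi>"
  shows "((\<lambda>h. (f (y + h *\<^sub>R (x - y)) - f y) / h) \<longlongrightarrow> (\<Sum>j=1..N. H j y (x j - y j))) (at_right 0)"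
proof -
  define box where "box e = (\<lambda>k. y k + e k *\<^sub>R (x k - y k))" for e :: "nat \<Rightarrow> real"
  \<comment> \<open>Coordinates before \<open>m\<close> have made their step of size \<open>h\<close>, coordinate \<open>m\<close> is at \<open>t\<close>, and those
    after \<open>m\<close> have not moved. So \<open>e 1 h 0\<close> is the start and \<open>e (Suc N) h 0\<close> the end of the path.\<close>
  define e where "e m h t = (\<lambda>k. if k \<in> {1..N} then if k < m then h else if k = m then t else 0 else 0)"
    for m :: nat and h t :: real
  have e_cube: "e m h t \<in> unit_cube N" if "h \<in> {0..1}" "t \<in> {0..1}" for m h t
    using that by (auto simp: e_def unit_cube_def)
  have box_prof: "box a \<in> profiles N \<pi>" if "a \<in> unit_cube N" for a
    unfolding box_def by (rule profiles_box[OF conv y x that])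
  have box_0: "box (e 1 h 0) = y" for h
    by (auto simp: box_def e_def fun_eq_iff)
  have box_h: "box (e (Suc N) h 0) = y + h *\<^sub>R (x - y)" for h
  proof
    fix k show "box (e (Suc N) h 0) k = (y + h *\<^sub>R (x - y)) k"
      using profiles_outside[OF x, of k] profiles_outside[OF y, of k]
      by (cases "k \<in> {1..N}") (auto simp: box_def e_def)
  qed
  have box_upd: "box (e m h t) = (box (e m h 0))(m := y m + t *\<^sub>R (x m - y m))" if "m \<in> {1..N}" for m h t
    using that by (auto simp: box_def e_def fun_eq_iff)
  have e_Suc: "e (Suc m) h 0 = e m h h" for m h
    by (auto simp: e_def fun_eq_iff)
  have "\<exists>t\<in>{0<..<h}. f (box (e m h h)) - f (box (e m h 0)) = h * H m (box (e m h t)) (x m - y m)"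
    if h: "h \<in> {0<..<1}" and m: "m \<in> {1..N}" for m h
  proof -
    define b where "b = box (e m h 0)"
    define F where "F t = f (box (e m h t))" for t
    define F' where "F' t = H m (box (e m h t)) (x m - y m)" for t
    have b: "b \<in> profiles N \<pi>"
      unfolding b_def using h by (intro box_prof e_cube) auto
    have e_b: "box (e m h t) = b(m := y m + t *\<^sub>R (x m - y m))" for t
      unfolding b_def by (rule box_upd[OF m])
    have "(F has_real_derivative F' t) (at t within {0..1})" if "t \<in> {0..1}" for t
      unfolding F_def F'_def e_b
      by (rule linear_derivative_along_segment[OF conv H[OF m] m b profilesD[OF y m] profilesD[OF x m] that])
    then have "(F has_real_derivative F' t) (at t within {0..h})" if "t \<in> {0..h}" for t
      by (rule DERIV_subset) (use that h in auto)
    then have F': "(F has_derivative (*) (F' t)) (at t within {0..h})" if "0 \<le> t" "t \<le> h" for t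
      by (rule has_field_derivative_imp_has_derivative) (use that in simp)
    have "0 < h" using h by simp
    from mvt_simple[OF this F'] obtain t where t: "t \<in> {0<..<h}" "F h - F 0 = F' t * (h - 0)"
      by blast
    have "F h - F 0 = h * F' t"
      using t(2) by simp
    with t(1) show ?thesis
      unfolding F_def F'_def by blast
  qed
  note mean_value = this
  define \<tau> where "\<tau> h m = (SOME t. t \<in> {0<..<h} \<and>
      f (box (e m h h)) - f (box (e m h 0)) = h * H m (box (e m h t)) (x m - y m))" for h m
  have \<tau>: "\<tau> h m \<in> {0<..<h} \<and>
      f (box (e m h h)) - f (box (e m h 0)) = h * H m (box (e m h (\<tau> h m))) (x m - y m)"
    if "h \<in> {0<..<1}" "m \<in> {1..N}" for h m
    unfolding \<tau>_def by (rule someI_ex) (use mean_value[OF that] in blast)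
  have \<tau>_in: "0 < \<tau> h m" "\<tau> h m < h" if "h \<in> {0<..<1}" "m \<in> {1..N}" for h m
    using \<tau>[OF that] by auto
  have small: "eventually (\<lambda>h. h \<in> {0<..<1}) (at_right (0::real))"
    by (rule eventually_at_rightI[of 0 1]) auto
  have "((\<lambda>h. H m (box (e m h (\<tau> h m))) (x m - y m)) \<longlongrightarrow> H m y (x m - y m)) (at_right 0)"
    if m: "m \<in> {1..N}" for m
  proof -
    have "((\<lambda>h. e m h (\<tau> h m) k) \<longlongrightarrow> 0) (at_right 0)" for k
    proof (rule tendsto_sandwich[of "\<lambda>_. 0" _ _ "\<lambda>h. h"])
      show "eventually (\<lambda>h. 0 \<le> e m h (\<tau> h m) k) (at_right 0)"
        using small by eventually_elim (use \<tau>_in[OF _ m] in \<open>auto simp: e_def intro: less_imp_le\<close>)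
      show "eventually (\<lambda>h. e m h (\<tau> h m) k \<le> h) (at_right 0)"
        using small by eventually_elim (use \<tau>_in[OF _ m] in \<open>auto simp: e_def intro: less_imp_le\<close>)
    qed (rule tendsto_const tendsto_ident_at)+
    then have "((\<lambda>h. e m h (\<tau> h m)) \<longlongrightarrow> 0) (at_right 0)"
      by (intro tendsto_fun_componentwise) simp
    moreover have "eventually (\<lambda>h. e m h (\<tau> h m) \<in> unit_cube N) (at_right 0)"
      using small by eventually_elim (use \<tau>_in[OF _ m] in \<open>force intro!: e_cube\<close>)
    ultimately have "((\<lambda>h. H m (box (e m h (\<tau> h m))) (x m - y m)) \<longlongrightarrow> H m (box 0) (x m - y m)) (at_right 0)"
      using continuous_within_tendsto_compose[OF cont[OF m], of "\<lambda>h. e m h (\<tau> h m)" "at_right 0"]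
      unfolding box_def by blast
    then show ?thesis by (simp add: box_def)
  qed
  then have "((\<lambda>h. \<Sum>m=1..N. H m (box (e m h (\<tau> h m))) (x m - y m)) \<longlongrightarrow> (\<Sum>m=1..N. H m y (x m - y m))) (at_right 0)"
    by (rule tendsto_sum)
  moreover have "eventually (\<lambda>h. (\<Sum>m=1..N. H m (box (e m h (\<tau> h m))) (x m - y m))
      = (f (y + h *\<^sub>R (x - y)) - f y) / h) (at_right 0)"
    using small
  proof eventually_elim
    case (elim h)
    have "f (y + h *\<^sub>R (x - y)) - f y = (\<Sum>m=1..N. f (box (e (Suc m) h 0)) - f (box (e m h 0)))"
      by (subst sum_Suc_diff) (simp, simp only: box_h box_0)
    also have "\<dots> = h * (\<Sum>m=1..N. H m (box (e m h (\<tau> h m))) (x m - y m))"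
      unfolding e_Suc sum_distrib_left by (intro sum.cong refl) (use \<tau>[OF elim] in blast)
    finally show ?case using elim by simp
  qed
  ultimately show ?thesis by (rule Lim_transform_eventually)
qed

text \<open>
  At an interior point the diagonal quotient is used twice, with the two ends \<open>\<phi>\<close> and \<open>z\<close> as targets.
  This is why continuity is assumed at every corner \<open>y\<close> and into every box.
\<close>

lemma chain_rule_along_segment:
  assumes conv: "convex (profiles N \<pi>)"
    and H: "\<And>j. j \<in> {1..N} \<Longrightarrow> linear_derivative N \<pi> j f (H j)"
    and cont: "\<And>j y x. j \<in> {1..N} \<Longrightarrow> y \<in> profiles N \<pi> \<Longrightarrow> x \<in> profiles N \<pi> \<Longrightarrow>
      continuous (at 0 within unit_cube N) (\<lambda>e. H j (\<lambda>k. y k + e k *\<^sub>R (x k - y k)) (x j - y j))"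
    and z: "z \<in> profiles N \<pi>" and \<phi>: "\<phi> \<in> profiles N \<pi>" and r: "r \<in> {0..1}"
  shows "((\<lambda>r. f (z + r *\<^sub>R (\<phi> - z))) has_real_derivative
           (\<Sum>j=1..N. H j (z + r *\<^sub>R (\<phi> - z)) (\<phi> j - z j))) (at r within {0..1})"
proof -
  define y where "y = z + r *\<^sub>R (\<phi> - z)"
  have y: "y \<in> profiles N \<pi>"
    unfolding y_def by (rule profiles_segment[OF conv z \<phi> r])
  have yj: "y j = z j + r *\<^sub>R (\<phi> j - z j)" for j
    by (simp add: y_def fun_eq_iff)
  have scale: "H j y (c *\<^sub>R (\<phi> j - z j)) = c * H j y (\<phi> j - z j)" if "j \<in> {1..N}" for j c
    using H[OF that] y profilesD[OF z that] profilesD[OF \<phi> that]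
    by (intro linear_functional_on_scaleR[of "span (\<pi> j)"] diff_in_span) (auto simp: linear_derivative_def)
  have quot: "((\<lambda>h. (f (y + h *\<^sub>R (x - y)) - f y) / h) \<longlongrightarrow> c * (\<Sum>j=1..N. H j y (\<phi> j - z j))) (at_right 0)"
    if x: "x \<in> profiles N \<pi>" and c: "\<And>j. x j - y j = c *\<^sub>R (\<phi> j - z j)" for x c
  proof -
    have "(\<Sum>j=1..N. H j y (x j - y j)) = c * (\<Sum>j=1..N. H j y (\<phi> j - z j))"
      unfolding c sum_distrib_left by (intro sum.cong refl scale) simp
    then show ?thesis
      using tendsto_diagonal_quotient[OF conv H cont[OF _ y x] y x] by (simp only:)
  qed
  show ?thesis
    unfolding y_def[symmetric]
  proof (rule has_real_derivative_on_unit_interval_by_endpoints[OF r])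
    have "y + \<epsilon> *\<^sub>R (\<phi> - y) = z + (r + \<epsilon> * (1 - r)) *\<^sub>R (\<phi> - z)" for \<epsilon>
      by (simp add: y_def algebra_simps)
    moreover have "\<phi> j - y j = (1 - r) *\<^sub>R (\<phi> j - z j)" for j
      by (simp add: yj algebra_simps)
    ultimately show "((\<lambda>\<epsilon>. (f (z + (r + \<epsilon> * (1 - r)) *\<^sub>R (\<phi> - z)) - f (z + r *\<^sub>R (\<phi> - z))) / \<epsilon>)
        \<longlongrightarrow> (1 - r) * (\<Sum>j=1..N. H j y (\<phi> j - z j))) (at_right 0)"
      using quot[OF \<phi>] by (simp only: flip: y_def)
  next
    have "y + \<epsilon> *\<^sub>R (z - y) = z + (r - \<epsilon> * r) *\<^sub>R (\<phi> - z)" for \<epsilon>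
      by (simp add: y_def algebra_simps)
    moreover have "z j - y j = (- r) *\<^sub>R (\<phi> j - z j)" for j
      by (simp add: yj algebra_simps)
    ultimately show "((\<lambda>\<epsilon>. (f (z + (r - \<epsilon> * r) *\<^sub>R (\<phi> - z)) - f (z + r *\<^sub>R (\<phi> - z))) / \<epsilon>)
        \<longlongrightarrow> - r * (\<Sum>j=1..N. H j y (\<phi> j - z j))) (at_right 0)"
      using quot[OF z] by (simp only: flip: y_def)
  qed
qed

section \<open>Value functions with a symmetric Jacobian\<close>

text \<open>
  For a fixed initial state, \<open>D i i\<close> is the component \<open>F\<^sub>i\<close> of the one-form and \<open>D2 i i j\<close> is the entry
  \<open>H\<^sub>i\<^sub>j\<close> of its Jacobian.
\<close>

locale symmetric_jacobian =
  fixes N :: nat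
    and \<pi> :: "nat \<Rightarrow> ('s, 'a::real_vector) policy set"
    and W :: "nat \<Rightarrow> ('s, 'a) profile \<Rightarrow> real"
    and D :: "nat \<Rightarrow> nat \<Rightarrow> ('s, 'a) profile \<Rightarrow> ('s, 'a) policy \<Rightarrow> real"
    and D2 :: "nat \<Rightarrow> nat \<Rightarrow> nat \<Rightarrow> ('s, 'a) profile \<Rightarrow> ('s, 'a) policy \<Rightarrow> ('s, 'a) policy \<Rightarrow> real"
  assumes convex_profiles: "convex (profiles N \<pi>)"
    and symmetric_conditions: "symmetric_derivative_conditions N \<pi> W D D2"
begin

lemma value_derivative: "i \<in> {1..N} \<Longrightarrow> linear_derivative N \<pi> i (W i) (D i i)"
  using symmetric_conditions
  by (auto simp: symmetric_derivative_conditions_def second_order_linear_derivatives_def)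

lemma gradient_derivative:
  assumes "i \<in> {1..N}" "j \<in> {1..N}" "u \<in> span (\<pi> i)"
  shows "linear_derivative N \<pi> j (\<lambda>\<phi>. D i i \<phi> u) (\<lambda>\<phi>. D2 i i j \<phi> u)"
  using symmetric_conditions assms
  by (auto simp: symmetric_derivative_conditions_def second_order_linear_derivatives_def)

lemma gradient_linear:
  "i \<in> {1..N} \<Longrightarrow> \<phi> \<in> profiles N \<pi> \<Longrightarrow> linear_functional_on (span (\<pi> i)) (D i i \<phi>)"
  using value_derivative by (auto simp: linear_derivative_def)

lemma jacobian_bilinear:
  assumes "i \<in> {1..N}" "j \<in> {1..N}" "\<phi> \<in> profiles N \<pi>"
  shows "bilinear_functional_on (span (\<pi> i)) (span (\<pi> j)) (D2 i i j \<phi>)"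
  using symmetric_conditions assms
  by (auto simp: symmetric_derivative_conditions_def second_order_linear_derivatives_def)

text \<open>
  The boundedness, continuity and symmetry conditions concern policies as directions, whereas the
  proof evaluates the Jacobian at differences of policies. The expansion into four terms transfers
  all three conditions.
\<close>

lemma jacobian_diff_diff:
  assumes "i \<in> {1..N}" "j \<in> {1..N}" "\<phi> \<in> profiles N \<pi>" "p \<in> \<pi> i" "q \<in> \<pi> i" "p' \<in> \<pi> j" "q' \<in> \<pi> j"
  shows "D2 i i j \<phi> (q - p) (q' - p') =
    D2 i i j \<phi> q q' - D2 i i j \<phi> q p' - (D2 i i j \<phi> p q' - D2 i i j \<phi> p p')"
proof -
  note s = assms(4-7)[THEN span_base]
  have l: "linear_functional_on (span (\<pi> i)) (\<lambda>u. D2 i i j \<phi> u v)" if "v \<in> span (\<pi> j)" for v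
    using jacobian_bilinear[OF assms(1-3)] that by (auto simp: bilinear_functional_on_def)
  have r: "linear_functional_on (span (\<pi> j)) (D2 i i j \<phi> u)" if "u \<in> span (\<pi> i)" for u
    using jacobian_bilinear[OF assms(1-3)] that by (auto simp: bilinear_functional_on_def)
  have "D2 i i j \<phi> (q - p) (q' - p') = D2 i i j \<phi> q (q' - p') - D2 i i j \<phi> p (q' - p')"
    by (rule linear_functional_on_diff[OF l s(2,1)]) (rule span_diff[OF s(4,3)])
  also have "\<dots> = D2 i i j \<phi> q q' - D2 i i j \<phi> q p' - (D2 i i j \<phi> p q' - D2 i i j \<phi> p p')"
    by (simp only: linear_functional_on_diff[OF r[OF s(1)] s(4,3)] linear_functional_on_diff[OF r[OF s(2)] s(4,3)])
  finally show ?thesis .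
qed

lemma jacobian_symmetric:
  assumes i: "i \<in> {1..N}" and j: "j \<in> {1..N}" and \<phi>: "\<phi> \<in> profiles N \<pi>"
    and p: "p \<in> \<pi> i" "q \<in> \<pi> i" and p': "p' \<in> \<pi> j" "q' \<in> \<pi> j"
  shows "D2 i i j \<phi> (q - p) (q' - p') = D2 j j i \<phi> (q' - p') (q - p)"
proof -
  have sym: "D2 i i j \<phi> a b = D2 j j i \<phi> b a" if "a \<in> \<pi> i" "b \<in> \<pi> j" for a b
    using symmetric_conditions i j \<phi> that unfolding symmetric_derivative_conditions_def by blast
  show ?thesis
    unfolding jacobian_diff_diff[OF i j \<phi> p p'] jacobian_diff_diff[OF j i \<phi> p' p]
    by (simp add: sym p p')
qed

lemma jacobian_bounded:
  assumes "i \<in> {1..N}" "j \<in> {1..N}" "z \<in> profiles N \<pi>" "\<phi> \<in> profiles N \<pi>"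
    and "p \<in> \<pi> i" "q \<in> \<pi> i" "p' \<in> \<pi> j"
  shows "bdd_above ((\<lambda>(r::real, \<epsilon>::real).
    \<bar>D2 i i j (z + r *\<^sub>R (\<phi>(i := \<phi> i + \<epsilon> *\<^sub>R (q - \<phi> i)) - z)) p p'\<bar>) ` ({0..1} \<times> {0..1}))"
  using symmetric_conditions assms
  unfolding symmetric_derivative_conditions_def by (elim ballE conjE; simp only: simp_thms)

lemma jacobian_continuous:
  assumes i: "i \<in> {1..N}" and j: "j \<in> {1..N}" and y: "y \<in> profiles N \<pi>" and x: "x \<in> profiles N \<pi>"
    and p: "p \<in> \<pi> i" "q \<in> \<pi> i" and p': "p' \<in> \<pi> j" "q' \<in> \<pi> j"
  shows "continuous (at 0 within unit_cube N) (\<lambda>e. D2 i i j (\<lambda>k. y k + e k *\<^sub>R (x k - y k)) (q - p) (q' - p'))"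
proof -
  let ?b = "\<lambda>e k. y k + e k *\<^sub>R (x k - y k)"
  have cont: "((\<lambda>e. D2 i i j (?b e) a b) \<longlongrightarrow> D2 i i j (?b 0) a b) (at 0 within unit_cube N)"
    if "a \<in> \<pi> i" "b \<in> \<pi> j" for a b
    using symmetric_conditions i j y x that
    unfolding symmetric_derivative_conditions_def continuous_within by blast
  have exp: "D2 i i j (?b e) (q - p) (q' - p') = D2 i i j (?b e) q q' - D2 i i j (?b e) q p'
      - (D2 i i j (?b e) p q' - D2 i i j (?b e) p p')" if "e \<in> unit_cube N" for e
    by (rule jacobian_diff_diff[OF i j profiles_box[OF convex_profiles y x that] p p'])
  have "0 \<in> unit_cube N" by (simp add: unit_cube_def)
  have "((\<lambda>e. D2 i i j (?b e) q q' - D2 i i j (?b e) q p' - (D2 i i j (?b e) p q' - D2 i i j (?b e) p p'))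
      \<longlongrightarrow> D2 i i j (?b 0) (q - p) (q' - p')) (at 0 within unit_cube N)"
    unfolding exp[OF \<open>0 \<in> unit_cube N\<close>] by (intro tendsto_diff cont p p')
  then show ?thesis
    unfolding continuous_within
    by (rule Lim_transform_eventually) (simp add: eventually_at_filter exp)
qed

lemma gradient_chain_rule:
  assumes i: "i \<in> {1..N}" and z: "z \<in> profiles N \<pi>" and \<phi>: "\<phi> \<in> profiles N \<pi>"
    and p: "p \<in> \<pi> i" "q \<in> \<pi> i" and r: "r \<in> {0..1}"
  shows "((\<lambda>r. D i i (z + r *\<^sub>R (\<phi> - z)) (q - p)) has_real_derivative
           (\<Sum>j=1..N. D2 i i j (z + r *\<^sub>R (\<phi> - z)) (q - p) (\<phi> j - z j))) (at r within {0..1})"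
  by (rule chain_rule_along_segment[OF convex_profiles gradient_derivative[OF i _ diff_in_span[OF p(2,1)]]
        jacobian_continuous[OF i _ _ _ p] z \<phi> r])
    (auto intro: profilesD)

lemma potential_integrand_continuous:
  assumes z: "z \<in> profiles N \<pi>" and \<phi>: "\<phi> \<in> profiles N \<pi>"
  shows "continuous_on {0..1} (potential_integrand N D z \<phi>)"
proof -
  have "continuous_on {0..1} (\<lambda>r. D j j (z + r *\<^sub>R (\<phi> - z)) (\<phi> j - z j))" if j: "j \<in> {1..N}" for j
    using gradient_chain_rule[OF j z \<phi> profilesD[OF z j] profilesD[OF \<phi> j]]
    by (rule DERIV_continuous_on)
  then show ?thesis
    unfolding potential_integrand_def by (intro continuous_on_sum)
qed

lemma potential_integrand_integrable:
  assumes "z \<in> profiles N \<pi>" "\<phi> \<in> profiles N \<pi>"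
  shows "set_integrable lborel {0..1} (potential_integrand N D z \<phi>)"
  by (rule borel_integrable_atLeastAtMost'[OF potential_integrand_continuous[OF assms]])

lemma integral_potential_eq_integral:
  assumes "z \<in> profiles N \<pi>" "\<phi> \<in> profiles N \<pi>"
  shows "integral_potential N D z \<phi> = integral {0..1} (potential_integrand N D z \<phi>)"
  unfolding integral_potential_def
  by (rule set_borel_integral_eq_integral(2)[OF potential_integrand_integrable[OF assms]])

end

section \<open>The surface swept out by a unilateral deviation\<close>

text \<open>
  Player \<open>i\<close> moves from \<open>\<phi> i\<close> to \<open>q\<close>, while \<open>z\<close> is the centre from which the potential is integrated.
\<close>

locale deviation_surface = symmetric_jacobian N \<pi> W D D2
  for N :: nat
    and \<pi> :: "nat \<Rightarrow> ('s, 'a::real_vector) policy set"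
    and W :: "nat \<Rightarrow> ('s, 'a) profile \<Rightarrow> real"
    and D :: "nat \<Rightarrow> nat \<Rightarrow> ('s, 'a) profile \<Rightarrow> ('s, 'a) policy \<Rightarrow> real"
    and D2 :: "nat \<Rightarrow> nat \<Rightarrow> nat \<Rightarrow> ('s, 'a) profile \<Rightarrow> ('s, 'a) policy \<Rightarrow> ('s, 'a) policy \<Rightarrow> real" +
  fixes z \<phi> :: "('s, 'a) profile" and i :: nat and q :: "('s, 'a) policy"
  assumes z: "z \<in> profiles N \<pi>" and \<phi>: "\<phi> \<in> profiles N \<pi>"
    and i: "i \<in> {1..N}" and q: "q \<in> \<pi> i"
begin

definition deviation :: "real \<Rightarrow> ('s, 'a) profile" where
  "deviation \<epsilon> = \<phi>(i := \<phi> i + \<epsilon> *\<^sub>R (q - \<phi> i))"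

definition surface :: "real \<Rightarrow> real \<Rightarrow> ('s, 'a) profile" where
  "surface \<epsilon> r = z + r *\<^sub>R (deviation \<epsilon> - z)"

lemma deviation_profile: "\<epsilon> \<in> {0..1} \<Longrightarrow> deviation \<epsilon> \<in> profiles N \<pi>"
  unfolding deviation_def
  by (intro profiles_upd \<phi> i policies_segment[OF convex_profiles \<phi> i profilesD[OF \<phi> i] q])

lemma surface_profile: "\<epsilon> \<in> {0..1} \<Longrightarrow> r \<in> {0..1} \<Longrightarrow> surface \<epsilon> r \<in> profiles N \<pi>"
  unfolding surface_def by (rule profiles_segment[OF convex_profiles z deviation_profile])

text \<open>The radial derivative of \<open>F\<^sub>i(\<sigma>; u)\<close>.\<close>

definition jacobian_flux :: "real \<Rightarrow> real \<Rightarrow> real" where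
  "jacobian_flux \<epsilon> r = (\<Sum>j=1..N. D2 i i j (surface \<epsilon> r) (q - \<phi> i) (deviation \<epsilon> j - z j))"

text \<open>
  The common value of \<open>\<partial>/\<partial>r (r F\<^sub>i(\<sigma>; u))\<close> and of the \<open>\<epsilon>\<close>-derivative of the integrand of the potential.
\<close>

definition surface_derivative :: "real \<Rightarrow> real \<Rightarrow> real" where
  "surface_derivative \<epsilon> r = D i i (surface \<epsilon> r) (q - \<phi> i) + r * jacobian_flux \<epsilon> r"

lemma radial_gradient_derivative:
  assumes "\<epsilon> \<in> {0..1}" "r \<in> {0..1}"
  shows "((\<lambda>r. D i i (surface \<epsilon> r) (q - \<phi> i)) has_real_derivative jacobian_flux \<epsilon> r) (at r within {0..1})"
  unfolding surface_def jacobian_flux_def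
  by (rule gradient_chain_rule[OF i z deviation_profile profilesD[OF \<phi> i] q]) (use assms in auto)

lemma radial_derivative:
  assumes "\<epsilon> \<in> {0..1}" "r \<in> {0..1}"
  shows "((\<lambda>r. r * D i i (surface \<epsilon> r) (q - \<phi> i)) has_real_derivative surface_derivative \<epsilon> r)
           (at r within {0..1})"
  unfolding surface_derivative_def
  by (rule derivative_eq_intros radial_gradient_derivative[OF assms] refl)+ simp

text \<open>
  For fixed \<open>r\<close> only coordinate \<open>i\<close> of the surface depends on \<open>\<epsilon>\<close>, and it runs through the segment from
  \<open>a\<close> to \<open>b\<close>, the points of player \<open>i\<close> at height \<open>r\<close> for \<open>\<epsilon> = 0\<close> and \<open>\<epsilon> = 1\<close>. Its direction \<open>r u\<close>
  accounts for the factor \<open>r\<close>. The symmetry of the Jacobian is used here: the derivative of \<open>F\<^sub>j\<close>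
  is \<open>H\<^sub>j\<^sub>i\<close>, and it is exchanged for \<open>H\<^sub>i\<^sub>j\<close>.
\<close>

lemma transversal_gradient_derivative:
  assumes j: "j \<in> {1..N}" and p: "p \<in> \<pi> j" and p': "p' \<in> \<pi> j" and \<epsilon>: "\<epsilon> \<in> {0..1}" and r: "r \<in> {0..1}"
  shows "((\<lambda>\<epsilon>. D j j (surface \<epsilon> r) (p' - p)) has_real_derivative
            r * D2 i i j (surface \<epsilon> r) (q - \<phi> i) (p' - p)) (at \<epsilon> within {0..1})"
proof -
  define a where "a = z i + r *\<^sub>R (\<phi> i - z i)"
  define b where "b = z i + r *\<^sub>R (q - z i)"
  define \<psi> where "\<psi> = surface 0 r"
  have a: "a \<in> \<pi> i" and b: "b \<in> \<pi> i"
    unfolding a_def b_def using policies_segment[OF convex_profiles z i profilesD[OF z i] _ r] profilesD[OF \<phi> i] q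
    by auto
  have \<psi>: "\<psi> \<in> profiles N \<pi>"
    unfolding \<psi>_def using r by (intro surface_profile) auto
  have ba: "b - a = r *\<^sub>R (q - \<phi> i)"
    by (simp add: a_def b_def algebra_simps)
  have surface: "surface \<epsilon> r = \<psi>(i := a + \<epsilon> *\<^sub>R (b - a))" for \<epsilon>
  proof
    fix k show "surface \<epsilon> r k = (\<psi>(i := a + \<epsilon> *\<^sub>R (b - a))) k"
      unfolding ba by (cases "k = i") (simp_all add: surface_def deviation_def \<psi>_def a_def fun_eq_iff algebra_simps)
  qed
  have "D2 j j i (surface \<epsilon> r) (p' - p) (b - a) = r * D2 j j i (surface \<epsilon> r) (p' - p) (q - \<phi> i)"
    unfolding ba using jacobian_bilinear[OF j i surface_profile[OF \<epsilon> r]] diff_in_span[OF p' p]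
    by (intro linear_functional_on_scaleR[of "span (\<pi> i)"] diff_in_span[OF q profilesD[OF \<phi> i]])
      (unfold bilinear_functional_on_def, blast)
  also have "\<dots> = r * D2 i i j (surface \<epsilon> r) (q - \<phi> i) (p' - p)"
    by (simp only: jacobian_symmetric[OF j i surface_profile[OF \<epsilon> r] p p' profilesD[OF \<phi> i] q])
  finally have "r * D2 i i j (surface \<epsilon> r) (q - \<phi> i) (p' - p) = D2 j j i (surface \<epsilon> r) (p' - p) (b - a)" ..
  then show ?thesis
    unfolding surface
    using linear_derivative_along_segment[OF convex_profiles gradient_derivative[OF j i diff_in_span[OF p' p]] i \<psi> a b \<epsilon>]
    by (simp only:)
qed

lemma deviation_direction: "deviation \<epsilon> i - z i = (\<phi> i - z i) + \<epsilon> *\<^sub>R (q - \<phi> i)"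
  by (simp add: deviation_def)

lemma jacobian_deviation_direction:
  assumes \<psi>: "\<psi> \<in> profiles N \<pi>"
  shows "D2 i i i \<psi> (q - \<phi> i) (deviation \<epsilon> i - z i) =
    D2 i i i \<psi> (q - \<phi> i) (\<phi> i - z i) + \<epsilon> * D2 i i i \<psi> (q - \<phi> i) (q - \<phi> i)"
proof -
  note s = diff_in_span[OF profilesD[OF \<phi> i] profilesD[OF z i]] diff_in_span[OF q profilesD[OF \<phi> i]]
  have "linear_functional_on (span (\<pi> i)) (D2 i i i \<psi> (q - \<phi> i))"
    using jacobian_bilinear[OF i i \<psi>] s(2) by (auto simp: bilinear_functional_on_def)
  then show ?thesis
    unfolding deviation_direction
    by (rule linear_functional_on_add_scaled[OF _ s])
qed

text \<open>
  In the summand \<open>j = i\<close> the direction \<open>\<phi>\<^sup>\<epsilon>\<^sub>i - z\<^sub>i\<close> also depends on \<open>\<epsilon>\<close>. The product rule then produces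
  the additional term \<open>F\<^sub>i(\<sigma>; u)\<close>, which is just what the radial derivative of \<open>r F\<^sub>i(\<sigma>; u)\<close> contains.
\<close>

lemma integrand_derivative:
  assumes \<epsilon>: "\<epsilon> \<in> {0..1}" and r: "r \<in> {0..1}"
  shows "((\<lambda>\<epsilon>. potential_integrand N D z (deviation \<epsilon>) r) has_real_derivative surface_derivative \<epsilon> r)
           (at \<epsilon> within {0..1})"
proof -
  let ?u = "q - \<phi> i"
  have "((\<lambda>\<epsilon>. D j j (surface \<epsilon> r) (deviation \<epsilon> j - z j)) has_real_derivative
      (if j = i then D i i (surface \<epsilon> r) ?u else 0) + r * D2 i i j (surface \<epsilon> r) ?u (deviation \<epsilon> j - z j))
      (at \<epsilon> within {0..1})" if j: "j \<in> {1..N}" for j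
  proof (cases "j = i")
    case False
    then have "deviation \<epsilon> j = \<phi> j" for \<epsilon> by (simp add: deviation_def)
    with False show ?thesis
      using transversal_gradient_derivative[OF j profilesD[OF z j] profilesD[OF \<phi> j] \<epsilon> r]
      by (simp only: if_False add_0)
  next
    case True
    note s = diff_in_span[OF profilesD[OF \<phi> i] profilesD[OF z i]] diff_in_span[OF q profilesD[OF \<phi> i]]
    have derivative: "((\<lambda>\<epsilon>. D i i (surface \<epsilon> r) (\<phi> i - z i) + \<epsilon> * D i i (surface \<epsilon> r) ?u) has_real_derivative
        r * D2 i i i (surface \<epsilon> r) ?u (\<phi> i - z i) +
          (1 * D i i (surface \<epsilon> r) ?u + r * D2 i i i (surface \<epsilon> r) ?u ?u * \<epsilon>)) (at \<epsilon> within {0..1})"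
      by (intro DERIV_add DERIV_mult DERIV_ident transversal_gradient_derivative i \<epsilon> r profilesD[OF z i] profilesD[OF \<phi> i] q)
    have expand: "D i i (surface \<epsilon> r) (deviation \<epsilon> i - z i) =
        D i i (surface \<epsilon> r) (\<phi> i - z i) + \<epsilon> * D i i (surface \<epsilon> r) ?u" if "\<epsilon> \<in> {0..1}" for \<epsilon>
      unfolding deviation_direction
      by (rule linear_functional_on_add_scaled[OF gradient_linear[OF i surface_profile[OF that r]] s])
    have "((\<lambda>\<epsilon>. D i i (surface \<epsilon> r) (deviation \<epsilon> i - z i)) has_real_derivative
        r * D2 i i i (surface \<epsilon> r) ?u (\<phi> i - z i) +
          (1 * D i i (surface \<epsilon> r) ?u + r * D2 i i i (surface \<epsilon> r) ?u ?u * \<epsilon>)) (at \<epsilon> within {0..1})"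
      by (rule has_field_derivative_transform_within[OF derivative zero_less_one \<epsilon>]) (simp only: expand)
    then show ?thesis
      using True by (simp add: jacobian_deviation_direction[OF surface_profile[OF \<epsilon> r]] algebra_simps del: fun_diff_def)
  qed
  then have "((\<lambda>\<epsilon>. potential_integrand N D z (deviation \<epsilon>) r) has_real_derivative
      (\<Sum>j=1..N. (if j = i then D i i (surface \<epsilon> r) ?u else 0)
        + r * D2 i i j (surface \<epsilon> r) ?u (deviation \<epsilon> j - z j))) (at \<epsilon> within {0..1})"
    unfolding potential_integrand_def surface_def[symmetric] by (rule DERIV_sum)
  moreover have "(\<Sum>j=1..N. (if j = i then D i i (surface \<epsilon> r) ?u else 0)
        + r * D2 i i j (surface \<epsilon> r) ?u (deviation \<epsilon> j - z j)) = surface_derivative \<epsilon> r"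
    using i unfolding surface_derivative_def jacobian_flux_def sum.distrib sum_distrib_left
    by (simp add: sum.delta)
  ultimately show ?thesis by simp
qed

lemma jacobian_bounded_on_surface:
  assumes j: "j \<in> {1..N}" and p: "p \<in> \<pi> j" "p' \<in> \<pi> j"
  shows "\<exists>C. \<forall>\<epsilon>\<in>{0..1}. \<forall>r\<in>{0..1}. \<bar>D2 i i j (surface \<epsilon> r) (q - \<phi> i) (p' - p)\<bar> \<le> C"
proof -
  have "\<exists>C. \<forall>\<epsilon>\<in>{0..1}. \<forall>r\<in>{0..1}. \<bar>D2 i i j (surface \<epsilon> r) a b\<bar> \<le> C"
    if ab: "a \<in> \<pi> i" "b \<in> \<pi> j" for a b
  proof -
    have "bdd_above ((\<lambda>(r::real, \<epsilon>::real). \<bar>D2 i i j (surface \<epsilon> r) a b\<bar>) ` ({0..1} \<times> {0..1}))"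
      unfolding surface_def deviation_def
      by (rule jacobian_bounded[OF i j z \<phi> ab(1) q ab(2)])
    then show ?thesis by (auto simp: bdd_above_def)
  qed
  note bd = this
  note \<phi>i = profilesD[OF \<phi> i]
  obtain A where A: "\<forall>\<epsilon>\<in>{0..1}. \<forall>r\<in>{0..1}. \<bar>D2 i i j (surface \<epsilon> r) q p'\<bar> \<le> A"
    using bd[OF q p(2)] ..
  obtain B where B: "\<forall>\<epsilon>\<in>{0..1}. \<forall>r\<in>{0..1}. \<bar>D2 i i j (surface \<epsilon> r) q p\<bar> \<le> B"
    using bd[OF q p(1)] ..
  obtain C where C: "\<forall>\<epsilon>\<in>{0..1}. \<forall>r\<in>{0..1}. \<bar>D2 i i j (surface \<epsilon> r) (\<phi> i) p'\<bar> \<le> C"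
    using bd[OF \<phi>i p(2)] ..
  obtain E where E: "\<forall>\<epsilon>\<in>{0..1}. \<forall>r\<in>{0..1}. \<bar>D2 i i j (surface \<epsilon> r) (\<phi> i) p\<bar> \<le> E"
    using bd[OF \<phi>i p(1)] ..
  note b = A[rule_format] B[rule_format] C[rule_format] E[rule_format]
  have "\<bar>D2 i i j (surface \<epsilon> r) (q - \<phi> i) (p' - p)\<bar> \<le> A + B + C + E"
    if "\<epsilon> \<in> {0..1}" "r \<in> {0..1}" for \<epsilon> r
    unfolding jacobian_diff_diff[OF i j surface_profile[OF that] \<phi>i q p]
    using b(1)[OF that] b(2)[OF that] b(3)[OF that] b(4)[OF that] by linarith
  then show ?thesis by blast
qed

lemma jacobian_flux_bounded: "\<exists>C. \<forall>\<epsilon>\<in>{0..1}. \<forall>r\<in>{0..1}. \<bar>jacobian_flux \<epsilon> r\<bar> \<le> C"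
proof -
  let ?u = "q - \<phi> i"
  have "\<exists>C. \<forall>\<epsilon>\<in>{0..1}. \<forall>r\<in>{0..1}. \<bar>D2 i i j (surface \<epsilon> r) ?u (deviation \<epsilon> j - z j)\<bar> \<le> C"
    if j: "j \<in> {1..N}" for j
  proof (cases "j = i")
    case False
    then have "deviation \<epsilon> j = \<phi> j" for \<epsilon> by (simp add: deviation_def)
    then show ?thesis
      using jacobian_bounded_on_surface[OF j profilesD[OF z j] profilesD[OF \<phi> j]] by (simp only:)
  next
    case True
    obtain A B where
      A: "\<And>\<epsilon> r. \<epsilon> \<in> {0..1} \<Longrightarrow> r \<in> {0..1} \<Longrightarrow> \<bar>D2 i i i (surface \<epsilon> r) ?u (\<phi> i - z i)\<bar> \<le> A" and
      B: "\<And>\<epsilon> r. \<epsilon> \<in> {0..1} \<Longrightarrow> r \<in> {0..1} \<Longrightarrow> \<bar>D2 i i i (surface \<epsilon> r) ?u ?u\<bar> \<le> B"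
      using jacobian_bounded_on_surface[OF i profilesD[OF z i] profilesD[OF \<phi> i]]
        jacobian_bounded_on_surface[OF i profilesD[OF \<phi> i] q] by metis
    have "\<bar>D2 i i i (surface \<epsilon> r) ?u (deviation \<epsilon> i - z i)\<bar> \<le> A + 1 * B"
      if "\<epsilon> \<in> {0..1}" "r \<in> {0..1}" for \<epsilon> r
    proof -
      have "\<bar>\<epsilon> * D2 i i i (surface \<epsilon> r) ?u ?u\<bar> \<le> 1 * B"
        unfolding abs_mult using that B[OF that] by (intro mult_mono) auto
      then show ?thesis
        unfolding jacobian_deviation_direction[OF surface_profile[OF that]]
        using A[OF that] by linarith
    qed
    then show ?thesis using True by blast
  qed
  then obtain C where C: "\<And>j \<epsilon> r. j \<in> {1..N} \<Longrightarrow> \<epsilon> \<in> {0..1} \<Longrightarrow> r \<in> {0..1} \<Longrightarrow>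
      \<bar>D2 i i j (surface \<epsilon> r) ?u (deviation \<epsilon> j - z j)\<bar> \<le> C j"
    by metis
  have "\<bar>jacobian_flux \<epsilon> r\<bar> \<le> (\<Sum>j=1..N. C j)" if "\<epsilon> \<in> {0..1}" "r \<in> {0..1}" for \<epsilon> r
    unfolding jacobian_flux_def using C that by (intro order_trans[OF sum_abs] sum_mono) auto
  then show ?thesis by blast
qed

text \<open>
  The hypotheses bound only second derivatives; \<open>F\<^sub>i(\<sigma>; u)\<close> is bounded because it starts at the fixed
  value \<open>F\<^sub>i(z; u)\<close> for \<open>r = 0\<close> and has bounded slope in \<open>r\<close>.
\<close>

lemma surface_derivative_bounded:
  "\<exists>C. \<forall>\<epsilon>\<in>{0..1}. \<forall>r\<in>{0..1}. \<bar>surface_derivative \<epsilon> r\<bar> \<le> C"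
proof -
  obtain C where C: "\<And>\<epsilon> r. \<epsilon> \<in> {0..1} \<Longrightarrow> r \<in> {0..1} \<Longrightarrow> \<bar>jacobian_flux \<epsilon> r\<bar> \<le> C"
    using jacobian_flux_bounded by blast
  have "\<bar>surface_derivative \<epsilon> r\<bar> \<le> \<bar>D i i z (q - \<phi> i)\<bar> + C + C" if \<epsilon>: "\<epsilon> \<in> {0..1}" and r: "r \<in> {0..1}" for \<epsilon> r
  proof -
    have z0: "surface \<epsilon> 0 = z" by (simp add: surface_def)
    have "norm (D i i (surface \<epsilon> r) (q - \<phi> i) - D i i (surface \<epsilon> 0) (q - \<phi> i)) \<le> C * norm (r - 0)"
      by (rule field_differentiable_bound[OF _ radial_gradient_derivative[OF \<epsilon>]]) (use C \<epsilon> r in auto)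
    moreover have "\<bar>r * jacobian_flux \<epsilon> r\<bar> \<le> 1 * C" "C * r \<le> C * 1"
      unfolding abs_mult using r C[OF \<epsilon> r] by (intro mult_mono mult_left_mono; simp)+
    ultimately show ?thesis
      using r unfolding surface_derivative_def z0 by simp
  qed
  then show ?thesis by blast
qed

lemma integral_potential_derivative:
  assumes \<epsilon>: "\<epsilon> \<in> {0..1}"
  shows "((\<lambda>\<epsilon>. integral_potential N D z (deviation \<epsilon>)) has_real_derivative
           D i i (deviation \<epsilon>) (q - \<phi> i)) (at \<epsilon> within {0..1})"
proof -
  obtain C where "\<And>\<epsilon> r. \<epsilon> \<in> {0..1} \<Longrightarrow> r \<in> {0..1} \<Longrightarrow> \<bar>surface_derivative \<epsilon> r\<bar> \<le> C"
    using surface_derivative_bounded by blast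
  then have "((\<lambda>\<epsilon>. integral {0..1} (potential_integrand N D z (deviation \<epsilon>))) has_real_derivative
      integral {0..1} (surface_derivative \<epsilon>)) (at \<epsilon> within {0..1})"
    by (intro leibniz_rule_bounded_derivative[OF integrand_derivative _ _ \<epsilon>] integrable_continuous_real
        potential_integrand_continuous z deviation_profile)
  moreover have "(surface_derivative \<epsilon> has_integral
      1 * D i i (surface \<epsilon> 1) (q - \<phi> i) - 0 * D i i (surface \<epsilon> 0) (q - \<phi> i)) {0..1}"
    by (rule fundamental_theorem_of_calculus[OF zero_le_one])
      (unfold has_real_derivative_iff_has_vector_derivative[symmetric], rule radial_derivative[OF \<epsilon>])
  then have "integral {0..1} (surface_derivative \<epsilon>) = D i i (deviation \<epsilon>) (q - \<phi> i)"
    by (simp add: surface_def integral_unique)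
  ultimately have "((\<lambda>\<epsilon>. integral {0..1} (potential_integrand N D z (deviation \<epsilon>))) has_real_derivative
      D i i (deviation \<epsilon>) (q - \<phi> i)) (at \<epsilon> within {0..1})"
    by (simp only:)
  then show ?thesis
    by (rule has_field_derivative_transform_within[OF _ zero_less_one \<epsilon>])
      (rule integral_potential_eq_integral[OF z deviation_profile, symmetric])
qed

text \<open>Both sides have the derivative \<open>F\<^sub>i(\<phi>\<^sup>\<epsilon>; u)\<close> along the deviation.\<close>

lemma potential_difference_eq_value_difference:
  "integral_potential N D z (\<phi>(i := q)) - integral_potential N D z \<phi> = W i (\<phi>(i := q)) - W i \<phi>"
proof -
  let ?d = "\<lambda>\<epsilon>. integral_potential N D z (deviation \<epsilon>) - W i (deviation \<epsilon>)"
  have value_along_deviation: "((\<lambda>\<epsilon>. W i (deviation \<epsilon>)) has_real_derivative D i i (deviation \<epsilon>) (q - \<phi> i)) (at \<epsilon> within {0..1})"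
    if "\<epsilon> \<in> {0..1}" for \<epsilon>
    unfolding deviation_def
    by (rule linear_derivative_along_segment[OF convex_profiles value_derivative[OF i] i \<phi> profilesD[OF \<phi> i] q that])
  have "(?d has_real_derivative D i i (deviation \<epsilon>) (q - \<phi> i) - D i i (deviation \<epsilon>) (q - \<phi> i))
      (at \<epsilon> within {0..1})" if "\<epsilon> \<in> {0..1}" for \<epsilon>
    by (intro DERIV_diff integral_potential_derivative value_along_deviation that)
  then have "\<exists>c. \<forall>\<epsilon>\<in>{0..1}. ?d \<epsilon> = c"
    by (intro has_field_derivative_zero_constant) (simp_all only: diff_self convex_closed_interval convex_real_interval)
  then have "?d 0 = ?d 1" by auto
  then show ?thesis by (simp add: deviation_def)
qed

end

section \<open>The potential\<close>

lemma (in symmetric_jacobian) integral_potential_is_potential: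
  assumes z: "z \<in> profiles N \<pi>" and V: "\<And>i. W i = V i s\<^sub>0"
  shows "closed_loop_potential_function N \<pi> V s\<^sub>0 (integral_potential N D z)"
  unfolding closed_loop_potential_function_def
proof (intro ballI)
  fix i p p' \<psi>
  assume i: "i \<in> {1..N}" and p: "p \<in> \<pi> i" and p': "p' \<in> \<pi> i" and \<psi>: "\<psi> \<in> PiE ({1..N} - {i}) \<pi>"
  have "\<psi>(i := p) \<in> profiles N \<pi>"
    using i p \<psi> by (auto simp: profiles_def PiE_iff extensional_def)
  then interpret deviation_surface N \<pi> W D D2 z "\<psi>(i := p)" i p'
    by unfold_locales (use z i p' in auto)
  show "integral_potential N D z (\<psi>(i := p')) - integral_potential N D z (\<psi>(i := p)) =
      V i s\<^sub>0 (\<psi>(i := p')) - V i s\<^sub>0 (\<psi>(i := p))"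
    using potential_difference_eq_value_difference by (simp add: V)
qed

text \<open>
  When some player has no policy, there is no profile to serve as the centre of integration, but
  then no deviations exist either.
\<close>

lemma closed_loop_potential_function_vacuous:
  assumes "profiles N \<pi> = {}"
  shows "closed_loop_potential_function N \<pi> V s\<^sub>0 \<Phi>"
  unfolding closed_loop_potential_function_def
proof (intro ballI)
  fix i p p' \<psi>
  assume "i \<in> {1..N}" "p \<in> \<pi> i" "\<psi> \<in> PiE ({1..N} - {i}) \<pi>"
  then have "\<psi>(i := p) \<in> profiles N \<pi>"
    by (auto simp: profiles_def PiE_iff extensional_def)
  with assms show "\<Phi> (\<psi>(i := p')) - \<Phi> (\<psi>(i := p)) = V i s\<^sub>0 (\<psi>(i := p')) - V i s\<^sub>0 (\<psi>(i := p))"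
    by blast
qed

theorem theorem4p3:
  fixes N :: nat
    and T :: "nat \<Rightarrow> 'a::real_vector topology"
    and A :: "nat \<Rightarrow> 'a set"
    and \<pi> :: "nat \<Rightarrow> ('s::topological_space, 'a) policy set"
    and V :: "nat \<Rightarrow> 's \<Rightarrow> ('s, 'a) profile \<Rightarrow> real"
    and D :: "'s \<Rightarrow> nat \<Rightarrow> nat \<Rightarrow> ('s, 'a) profile \<Rightarrow> ('s, 'a) policy \<Rightarrow> real"
    and D2 :: "'s \<Rightarrow> nat \<Rightarrow> nat \<Rightarrow> nat \<Rightarrow> ('s, 'a) profile
                 \<Rightarrow> ('s, 'a) policy \<Rightarrow> ('s, 'a) policy \<Rightarrow> real"
  assumes "game N T A \<pi>"
    and "convex (profiles N \<pi>)"
  shows "(\<forall>s\<^sub>0. symmetric_derivative_conditions N \<pi> (\<lambda>i. V i s\<^sub>0) (D s\<^sub>0) (D2 s\<^sub>0) \<longrightarrow>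
            closed_loop_potential_game N \<pi> V s\<^sub>0 \<and>
            (\<forall>z\<in>profiles N \<pi>.
               (\<forall>\<phi>\<in>profiles N \<pi>.
                  set_integrable lborel {0..1} (potential_integrand N (D s\<^sub>0) z \<phi>)) \<and>
               closed_loop_potential_function N \<pi> V s\<^sub>0 (integral_potential N (D s\<^sub>0) z))) \<and>
         ((\<forall>s\<^sub>0. symmetric_derivative_conditions N \<pi> (\<lambda>i. V i s\<^sub>0) (D s\<^sub>0) (D2 s\<^sub>0)) \<longrightarrow>
            Markov_potential_game N \<pi> V \<and>
            (\<forall>z\<in>profiles N \<pi>.
               Markov_potential_function N \<pi> V (\<lambda>s. integral_potential N (D s) z)))"
proof -
  have potential: "closed_loop_potential_function N \<pi> V s\<^sub>0 (integral_potential N (D s\<^sub>0) z)"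
    and integrable: "\<phi> \<in> profiles N \<pi> \<Longrightarrow>
      set_integrable lborel {0..1} (potential_integrand N (D s\<^sub>0) z \<phi>)"
    if sdc: "symmetric_derivative_conditions N \<pi> (\<lambda>i. V i s\<^sub>0) (D s\<^sub>0) (D2 s\<^sub>0)"
      and z: "z \<in> profiles N \<pi>" for s\<^sub>0 z \<phi>
  proof -
    interpret symmetric_jacobian N \<pi> "\<lambda>i. V i s\<^sub>0" "D s\<^sub>0" "D2 s\<^sub>0"
      by unfold_locales (fact assms(2), fact sdc)
    show "closed_loop_potential_function N \<pi> V s\<^sub>0 (integral_potential N (D s\<^sub>0) z)"
      by (rule integral_potential_is_potential[OF z]) (rule refl)
    show "set_integrable lborel {0..1} (potential_integrand N (D s\<^sub>0) z \<phi>)" if "\<phi> \<in> profiles N \<pi>"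
      by (rule potential_integrand_integrable[OF z that])
  qed
  show ?thesis
  proof (cases "profiles N \<pi> = {}")
    case True
    then show ?thesis
      by (auto simp: closed_loop_potential_game_def Markov_potential_game_def Markov_potential_function_def
          closed_loop_potential_function_vacuous)
  next
    case False
    then obtain z where z: "z \<in> profiles N \<pi>" by blast
    have "closed_loop_potential_game N \<pi> V s\<^sub>0"
      if "symmetric_derivative_conditions N \<pi> (\<lambda>i. V i s\<^sub>0) (D s\<^sub>0) (D2 s\<^sub>0)" for s\<^sub>0
      using potential[OF that z] unfolding closed_loop_potential_game_def by blast
    moreover have "Markov_potential_function N \<pi> V (\<lambda>s. integral_potential N (D s) z)"
      if "\<forall>s\<^sub>0. symmetric_derivative_conditions N \<pi> (\<lambda>i. V i s\<^sub>0) (D s\<^sub>0) (D2 s\<^sub>0)"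
        and "z \<in> profiles N \<pi>" for z
      using potential that unfolding Markov_potential_function_def by blast
    ultimately show ?thesis
      using potential integrable z unfolding Markov_potential_game_def by blast
  qed
qed

end
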